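(* Let $\alpha>0$ and $\beta\in\mathbb{R}$, and let $\mathfrak{g}=\mathfrak{g}_{4.6}^{\alpha,\beta}$ be the four-dimensional real Lie algebra with basis $\mathcal{B}=\{e_1,e_2,e_3,e_4\}$ whose nonzero Lie brackets (up to skew-symmetry) are $[e_1,e_4]=\alpha e_1$, $[e_2,e_4]=\beta e_2-e_3$, $[e_3,e_4]=e_2+\beta e_3$. Let $\langle\cdot,\cdot\rangle$ be a pseudo-Riemannian inner product on $\mathfrak{g}$ and let $(R_{ij})$ be the matrix of its Ricci operator $\operatorname{Ric}$ in the basis $\mathcal{B}$. If $$R_{4i}=0\ (i=1,2,3),\quad R_{33}=R_{22},\quad R_{32}=-R_{23},$$ $$\beta R_{21}+R_{31}=\alpha R_{21},\quad -R_{21}+\beta R_{31}=\alpha R_{31},\quad \alpha R_{12}=\beta R_{12}-R_{13},\quad \alpha R_{13}=R_{12}+\beta R_{13},$$ then $\langle\cdot,\cdot\rangle$ is an algebraic Ricci soliton. In this case, $\operatorname{Ric}=\eta I_4+D$ where $\eta=R_{44}$ and $$D=\begin{bmatrix}R_{11}-R_{44}&R_{12}&R_{13}&R_{14}\\R_{21}&R_{22}-R_{44}&R_{23}&R_{24}\\R_{31}&-R_{23}&R_{22}-R_{44}&R_{34}\\0&0&0&0\end{bmatrix}$$ is (the matrix in the basis $\mathcal{B}$ of) a derivation of $\mathfrak{g}$. In particular, if $\beta=0$, these relations imply $R_{12}=R_{13}=R_{21}=R_{31}=0$, so that $$D=\begin{bmatrix}R_{11}-R_{44}&0&0&R_{1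4}\\0&R_{22}-R_{44}&R_{23}&R_{24}\\0&-R_{23}&R_{22}-R_{44}&R_{34}\\0&0&0&0\end{bmatrix}.$$
   Context: A pseudo-Riemannian inner product on a real Lie algebra $\mathfrak{g}$ is a nondegenerate symmetric bilinear form $\langle\cdot,\cdot\rangle$ on $\mathfrak{g}$ (of some signature $(r,s)$). Its Levi-Civita connection $\nabla$ is defined by $2\langle\nabla_uv,w\rangle=\langle[u,v],w\rangle+\langle[w,u],v\rangle+\langle[w,v],u\rangle$; its curvature is $R_{uv}=\nabla_{[u,v]}-[\nabla_u,\nabla_v]$; its Ricci curvature $\operatorname{ric}(u,v)$ is the trace of $w\mapsto R_{uw}v$; its Ricci operator $\operatorname{Ric}$ is the endomorphism of $\mathfrak{g}$ with $\langle\operatorname{Ric}(u),v\rangle=\operatorname{ric}(u,v)$. The matrix $(R_{ij})$ of $\operatorname{Ric}$ in a basis $\{e_i\}$ is given by $\operatorname{Ric}(e_j)=\sum_iR_{ij}e_i$ (the same column convention is used for $D$). A derivation is a linear map $D:\mathfrak{g}\to\mathfrak{g}$ with $D[x,y]=[D(x),y]+[x,D(y)]$ for all $x,y$. The inner product is an algebraic Ricci soliton if $\operatorname{Ric}=\eta\,\mathrm{Id}_{\mathfrak{g}}+D$ for some $\eta\in\mathbb{R}$ and some derivation $D$ of $\mathfrak{g}$. *)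

theory Defs
  imports "HOL-Analysis.Analysis"
begin

section \<open>Real Lie algebras and derivations\<close>

definition lie_algebra :: "('g::real_vector \<Rightarrow> 'g \<Rightarrow> 'g) \<Rightarrow> bool" where
  "lie_algebra br \<longleftrightarrow> bilinear br \<and> (\<forall>x. br x x = 0) \<and>
     (\<forall>x y z. br x (br y z) + br y (br z x) + br z (br x y) = 0)"

definition derivation :: "('g::real_vector \<Rightarrow> 'g \<Rightarrow> 'g) \<Rightarrow> ('g \<Rightarrow> 'g) \<Rightarrow> bool" where
  "derivation br D \<longleftrightarrow> linear D \<and> (\<forall>x y. D (br x y) = br (D x) y + br x (D y))"


section \<open>Bases, matrices and traces\<close>

definition is_basis :: "('n::finite \<Rightarrow> 'g::real_vector) \<Rightarrow> bool" where
  "is_basis e \<longleftrightarrow> inj e \<and> independent (range e) \<and> span (range e) = UNIV"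

text \<open>Column convention: \<open>f (e j) = (\<Sum>i. (matrix_wrt e f $ i $ j) *\<^sub>R e i)\<close>.\<close>

definition matrix_wrt :: "('n::finite \<Rightarrow> 'g::real_vector) \<Rightarrow> ('g \<Rightarrow> 'g) \<Rightarrow> real^'n^'n" where
  "matrix_wrt e f = (\<chi> i j. representation (range e) (f (e j)) (e i))"

text \<open>The set \<^term>\<open>extend_basis {}\<close> is some basis of the whole space; the value does not depend
  on this choice, see \<open>endo_trace_eq\<close> below.\<close>

definition endo_trace :: "('g::real_vector \<Rightarrow> 'g) \<Rightarrow> real" where
  "endo_trace f = (let B = extend_basis {} in \<Sum>b\<in>B. representation B (f b) b)"


section \<open>Pseudo-Riemannian inner products, Ricci operator, algebraic Ricci solitons\<close>

definition pseudo_riemannian :: "('g::real_vector \<Rightarrow> 'g \<Rightarrow> real) \<Rightarrow> bool" where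
  "pseudo_riemannian g \<longleftrightarrow> bilinear g \<and> (\<forall>u v. g u v = g v u) \<and>
     (\<forall>u. (\<forall>v. g u v = 0) \<longrightarrow> u = 0)"

text \<open>On a finite-dimensional Lie algebra the vectors described by \<open>THE\<close> in the next definition
  and in \<open>ricci_operator\<close> exist and are unique: see \<open>levi_civita_iff\<close> and \<open>ricci_operator_iff\<close>.\<close>

definition levi_civita ::
  "('g::real_vector \<Rightarrow> 'g \<Rightarrow> 'g) \<Rightarrow> ('g \<Rightarrow> 'g \<Rightarrow> real) \<Rightarrow> 'g \<Rightarrow> 'g \<Rightarrow> 'g" where
  "levi_civita br g u v =
     (THE x. \<forall>w. 2 * g x w = g (br u v) w + g (br w u) v + g (br w v) u)"

definition curvature ::
  "('g::real_vector \<Rightarrow> 'g \<Rightarrow> 'g) \<Rightarrow> ('g \<Rightarrow> 'g \<Rightarrow> real) \<Rightarrow> 'g \<Rightarrow> 'g \<Rightarrow> 'g \<Rightarrow> 'g" where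
  "curvature br g u v x =
     levi_civita br g (br u v) x -
     (levi_civita br g u (levi_civita br g v x) - levi_civita br g v (levi_civita br g u x))"

definition ricci ::
  "('g::real_vector \<Rightarrow> 'g \<Rightarrow> 'g) \<Rightarrow> ('g \<Rightarrow> 'g \<Rightarrow> real) \<Rightarrow> 'g \<Rightarrow> 'g \<Rightarrow> real" where
  "ricci br g u v = endo_trace (\<lambda>w. curvature br g u w v)"

definition ricci_operator ::
  "('g::real_vector \<Rightarrow> 'g \<Rightarrow> 'g) \<Rightarrow> ('g \<Rightarrow> 'g \<Rightarrow> real) \<Rightarrow> 'g \<Rightarrow> 'g" where
  "ricci_operator br g u = (THE x. \<forall>v. g x v = ricci br g u v)"

definition algebraic_ricci_soliton ::
  "('g::real_vector \<Rightarrow> 'g \<Rightarrow> 'g) \<Rightarrow> ('g \<Rightarrow> 'g \<Rightarrow> real) \<Rightarrow> bool" where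
  "algebraic_ricci_soliton br g \<longleftrightarrow>
     (\<exists>\<eta> D. derivation br D \<and> (\<forall>x. ricci_operator br g x = \<eta> *\<^sub>R x + D x))"


section \<open>The Lie algebra \<open>g_4_6\<close>\<close>

definition lie_algebra_4_6 ::
  "real \<Rightarrow> real \<Rightarrow> ('g::real_vector \<Rightarrow> 'g \<Rightarrow> 'g) \<Rightarrow> (4 \<Rightarrow> 'g) \<Rightarrow> bool" where
  "lie_algebra_4_6 \<alpha> \<beta> br e \<longleftrightarrow> lie_algebra br \<and> is_basis e \<and>
     br (e 1) (e 4) = \<alpha> *\<^sub>R e 1 \<and>
     br (e 2) (e 4) = \<beta> *\<^sub>R e 2 - e 3 \<and>
     br (e 3) (e 4) = e 2 + \<beta> *\<^sub>R e 3 \<and>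
     br (e 1) (e 2) = 0 \<and> br (e 1) (e 3) = 0 \<and> br (e 2) (e 3) = 0"


section \<open>Well-definedness of the notions above\<close>

lemma is_basis_sum:
  assumes "is_basis e"
  shows "(\<Sum>i\<in>UNIV. representation (range e) v (e i) *\<^sub>R e i) = v"
proof -
  have "(\<Sum>b\<in>range e. representation (range e) v b *\<^sub>R b) = v"
    using assms by (intro real_vector.sum_representation_eq) (auto simp: is_basis_def)
  then show ?thesis
    using assms by (subst (asm) sum.reindex) (auto simp: is_basis_def)
qed

lemma is_basis_representation:
  assumes "is_basis e"
  shows "representation (range e) (e j) (e i) = (if i = j then 1 else 0)"
  using assms by (auto simp: is_basis_def real_vector.representation_basis inj_eq)

lemma is_basis_linear_representation:
  assumes "is_basis e"
  shows "linear (\<lambda>v. representation (range e) v b)"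
proof -
  have "independent (range e)" "span (range e) = UNIV"
    using assms by (auto simp: is_basis_def)
  from real_vector.linear_representation[OF this] show ?thesis
    by (simp add: linear_def real_scaleR_def[abs_def])
qed

lemma matrix_wrt_column:
  assumes "is_basis e"
  shows "f (e j) = (\<Sum>i\<in>UNIV. (matrix_wrt e f $ i $ j) *\<^sub>R e i)"
  using is_basis_sum[OF assms, of "f (e j)"] by (simp add: matrix_wrt_def)

lemma endo_trace_eq:
  fixes e :: "'n::finite \<Rightarrow> 'g::real_vector"
  assumes e: "is_basis e" and f: "linear f"
  shows "endo_trace f = trace (matrix_wrt e f)"
proof -
  define B :: "'g set" where "B = extend_basis {}"
  have B: "independent B" "span B = UNIV"
    using real_vector.independent_extend_basis[OF real_vector.independent_empty]
      real_vector.span_extend_basis[OF real_vector.independent_empty]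
    by (simp_all add: B_def)
  have e': "independent (range e)" "span (range e) = UNIV" using e by (auto simp: is_basis_def)
  have fin: "finite B"
    using real_vector.independent_span_bound[OF _ B(1), of "range e"] e' by auto
  let ?r = "\<lambda>v i. representation (range e) v (e i)" and ?s = "representation B"
  have lr: "linear (\<lambda>v. ?r v i)" for i by (rule is_basis_linear_representation[OF e])
  have ls: "linear (\<lambda>v. ?s v b)" for b
    using real_vector.linear_representation[OF B] by (simp add: linear_def real_scaleR_def[abs_def])
  have "endo_trace f = (\<Sum>b\<in>B. ?s (f b) b)"
    by (simp add: endo_trace_def B_def Let_def)
  also have "\<dots> = (\<Sum>b\<in>B. \<Sum>i\<in>UNIV. ?r b i * ?s (f (e i)) b)"
  proof (rule sum.cong)
    fix b
    have "?s (f b) b = ?s (f (\<Sum>i\<in>UNIV. ?r b i *\<^sub>R e i)) b" by (simp add: is_basis_sum[OF e])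
    also have "\<dots> = (\<Sum>i\<in>UNIV. ?r b i * ?s (f (e i)) b)"
      by (simp add: linear_sum[OF f] linear_sum[OF ls] linear_scale[OF f] linear_scale[OF ls])
    finally show "?s (f b) b = (\<Sum>i\<in>UNIV. ?r b i * ?s (f (e i)) b)" .
  qed simp
  also have "\<dots> = (\<Sum>i\<in>UNIV. \<Sum>b\<in>B. ?r b i * ?s (f (e i)) b)"
    by (rule sum.swap)
  also have "\<dots> = (\<Sum>i\<in>UNIV. ?r (f (e i)) i)"
  proof (rule sum.cong)
    fix i
    have "(\<Sum>b\<in>B. ?s (f (e i)) b *\<^sub>R b) = f (e i)"
      using B fin by (intro real_vector.sum_representation_eq) auto
    then have "?r (f (e i)) i = ?r (\<Sum>b\<in>B. ?s (f (e i)) b *\<^sub>R b) i" by simp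
    also have "\<dots> = (\<Sum>b\<in>B. ?r b i * ?s (f (e i)) b)"
      by (simp add: linear_sum[OF lr] linear_scale[OF lr] mult.commute)
    finally show "(\<Sum>b\<in>B. ?r b i * ?s (f (e i)) b) = ?r (f (e i)) i" by simp
  qed simp
  finally show ?thesis by (simp add: trace_def matrix_wrt_def)
qed

lemma pseudo_riemannian_unique:
  assumes "pseudo_riemannian g" "\<And>w. g x w = g y w"
  shows "x = y"
proof -
  have "bilinear g" using assms(1) by (simp add: pseudo_riemannian_def)
  then have "g (x - y) w = 0" for w
    using assms(2) by (simp add: bilinear_lsub)
  then have "x - y = 0" using assms(1) by (metis pseudo_riemannian_def)
  then show ?thesis by simp
qed

lemma pseudo_riemannian_represents:
  fixes e :: "'n::finite \<Rightarrow> 'g::real_vector" and g :: "'g \<Rightarrow> 'g \<Rightarrow> real"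
  assumes e: "is_basis e" and g: "pseudo_riemannian g" and \<phi>: "linear \<phi>"
  shows "\<exists>x. \<forall>w. g x w = \<phi> w"
proof -
  define S where "S = (\<lambda>c::real^'n. \<Sum>i\<in>UNIV. c $ i *\<^sub>R e i)"
  define T where "T = (\<lambda>x. (\<chi> i. g x (e i)) :: real^'n)"
  have bl: "linear (\<lambda>x. g x y)" "linear (g x)" for x y
    using g by (auto simp: pseudo_riemannian_def bilinear_def)
  have ex: "w = (\<Sum>i\<in>UNIV. representation (range e) w (e i) *\<^sub>R e i)" for w
    by (simp add: is_basis_sum[OF e])
  have linS: "linear S"
    by (rule linearI) (auto simp: S_def algebra_simps sum.distrib scaleR_sum_right)
  have linT: "linear T"
    by (rule linearI) (auto simp: T_def vec_eq_iff linear_add[OF bl(1)] linear_scale[OF bl(1)])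
  have ext: "\<psi> w = \<phi>' w" if "linear \<psi>" "linear \<phi>'" "\<And>i. \<psi> (e i) = \<phi>' (e i)"
    for \<psi> \<phi>' :: "'g \<Rightarrow> real" and w
    by (subst (1 2) ex) (simp add: linear_sum that(1,2) linear_scale that(3))
  have injT: "x = y" if "T x = T y" for x y
    using ext[OF bl(2) bl(2), of x y] that
    by (intro pseudo_riemannian_unique[OF g]) (auto simp: T_def vec_eq_iff)
  have injS: "inj S"
  proof (rule injI)
    fix c d assume "S c = S d"
    have r: "representation (range e) (S c) (e i) = c $ i" for c i
      unfolding S_def
      by (simp add: linear_sum[OF is_basis_linear_representation[OF e]]
          linear_scale[OF is_basis_linear_representation[OF e]] is_basis_representation[OF e]
          if_distrib[of "\<lambda>x. _ * x"] cong: if_cong)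
    show "c = d" by (metis r \<open>S c = S d\<close> vec_eq_iff)
  qed
  have "inj (T \<circ> S)" using injT injS by (auto simp: inj_def)
  then have "surj (T \<circ> S)"
    by (rule linear_injective_imp_surjective[OF linear_compose[OF linS linT]]) simp_all
  then obtain c where c: "T (S c) = (\<chi> i. \<phi> (e i))" by (metis comp_apply surjD)
  have "g (S c) w = \<phi> w" for w
    by (rule ext[OF bl(2) \<phi>]) (use c in \<open>simp add: T_def vec_eq_iff\<close>)
  then show ?thesis by blast
qed

lemma levi_civita_iff:
  fixes br :: "'g::real_vector \<Rightarrow> 'g \<Rightarrow> 'g" and e :: "'n::finite \<Rightarrow> 'g"
  assumes br: "lie_algebra br" and e: "is_basis e" and g: "pseudo_riemannian g"
  shows "levi_civita br g u v = x \<longleftrightarrow>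
    (\<forall>w. 2 * g x w = g (br u v) w + g (br w u) v + g (br w v) u)"
proof -
  let ?\<phi> = "\<lambda>w. (g (br u v) w + g (br w u) v + g (br w v) u) / 2"
  have b: "bilinear br" "bilinear g"
    using br g by (auto simp: lie_algebra_def pseudo_riemannian_def)
  have "linear ?\<phi>"
    by (rule linearI) (auto simp: bilinear_ladd[OF b(1)] bilinear_ladd[OF b(2)] bilinear_radd[OF b(2)]
        bilinear_lmul[OF b(1)] bilinear_lmul[OF b(2)] bilinear_rmul[OF b(2)] field_simps)
  from pseudo_riemannian_represents[OF e g this] obtain y where y: "\<And>w. g y w = ?\<phi> w" by blast
  have "\<exists>!x. \<forall>w. 2 * g x w = g (br u v) w + g (br w u) v + g (br w v) u"
  proof (rule ex1I[of _ y])
    show "\<forall>w. 2 * g y w = g (br u v) w + g (br w u) v + g (br w v) u" by (simp add: y)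
  next
    fix z assume z: "\<forall>w. 2 * g z w = g (br u v) w + g (br w u) v + g (br w v) u"
    have "g z w = g y w" for w using z[rule_format, of w] by (simp add: y)
    then show "z = y" by (rule pseudo_riemannian_unique[OF g])
  qed
  from theI'[OF this] this show ?thesis unfolding levi_civita_def by blast
qed

lemma bilinear_levi_civita:
  fixes br :: "'g::real_vector \<Rightarrow> 'g \<Rightarrow> 'g" and e :: "'n::finite \<Rightarrow> 'g"
  assumes br: "lie_algebra br" and e: "is_basis e" and g: "pseudo_riemannian g"
  shows "bilinear (levi_civita br g)"
proof -
  have b: "bilinear br" "bilinear g"
    using br g by (auto simp: lie_algebra_def pseudo_riemannian_def)
  note L = levi_civita_iff[OF assms, THEN iffD1, OF refl, rule_format]
  note s = bilinear_ladd[OF b(1)] bilinear_radd[OF b(1)] bilinear_ladd[OF b(2)] bilinear_radd[OF b(2)]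
    bilinear_lmul[OF b(1)] bilinear_rmul[OF b(1)] bilinear_lmul[OF b(2)] bilinear_rmul[OF b(2)]
  show ?thesis
    unfolding bilinear_def
    by (intro conjI allI linearI; subst levi_civita_iff[OF assms], intro allI)
      (simp_all add: s algebra_simps L mult.left_commute[of 2])
qed

lemma linear_curvature:
  fixes br :: "'g::real_vector \<Rightarrow> 'g \<Rightarrow> 'g" and e :: "'n::finite \<Rightarrow> 'g"
  assumes br: "lie_algebra br" and e: "is_basis e" and g: "pseudo_riemannian g"
  shows "linear (\<lambda>u. curvature br g u v x)" "linear (\<lambda>v. curvature br g u v x)"
    "linear (\<lambda>x. curvature br g u v x)"
proof -
  have b: "bilinear br" using br by (auto simp: lie_algebra_def)
  note n = bilinear_levi_civita[OF assms]
  note s = bilinear_ladd[OF b] bilinear_radd[OF b] bilinear_ladd[OF n] bilinear_radd[OF n]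
    bilinear_lmul[OF b] bilinear_rmul[OF b] bilinear_lmul[OF n] bilinear_rmul[OF n]
  show "linear (\<lambda>u. curvature br g u v x)" "linear (\<lambda>v. curvature br g u v x)"
    "linear (\<lambda>x. curvature br g u v x)"
    by (rule linearI; simp add: curvature_def s algebra_simps)+
qed

lemma bilinear_ricci:
  fixes br :: "'g::real_vector \<Rightarrow> 'g \<Rightarrow> 'g" and e :: "'n::finite \<Rightarrow> 'g"
  assumes br: "lie_algebra br" and e: "is_basis e" and g: "pseudo_riemannian g"
  shows "bilinear (ricci br g)"
proof -
  note c = linear_curvature[OF assms]
  note r = is_basis_linear_representation[OF e]
  have eq: "ricci br g u v = (\<Sum>i\<in>UNIV. representation (range e) (curvature br g u (e i) v) (e i))"
    for u v
    by (simp add: ricci_def endo_trace_eq[OF e c(2)] trace_def matrix_wrt_def)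
  show ?thesis
    unfolding bilinear_def eq
    by (intro conjI allI linearI)
      (simp_all add: linear_add[OF c(1)] linear_add[OF c(3)] linear_scale[OF c(1)] linear_scale[OF c(3)]
        linear_add[OF r] linear_scale[OF r] sum.distrib sum_distrib_left)
qed

lemma ricci_operator_iff:
  fixes br :: "'g::real_vector \<Rightarrow> 'g \<Rightarrow> 'g" and e :: "'n::finite \<Rightarrow> 'g"
  assumes br: "lie_algebra br" and e: "is_basis e" and g: "pseudo_riemannian g"
  shows "ricci_operator br g u = x \<longleftrightarrow> (\<forall>v. g x v = ricci br g u v)"
proof -
  have "linear (ricci br g u)" using bilinear_ricci[OF assms] by (simp add: bilinear_def)
  from pseudo_riemannian_represents[OF e g this]
  have "\<exists>!x. \<forall>v. g x v = ricci br g u v"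
    by (metis pseudo_riemannian_unique[OF g])
  from theI'[OF this] this show ?thesis unfolding ricci_operator_def by blast
qed

lemma linear_ricci_operator:
  fixes br :: "'g::real_vector \<Rightarrow> 'g \<Rightarrow> 'g" and e :: "'n::finite \<Rightarrow> 'g"
  assumes br: "lie_algebra br" and e: "is_basis e" and g: "pseudo_riemannian g"
  shows "linear (ricci_operator br g)"
proof -
  have b: "bilinear g" using g by (auto simp: pseudo_riemannian_def)
  note n = bilinear_ricci[OF assms]
  note L = ricci_operator_iff[OF assms, THEN iffD1, OF refl, rule_format]
  show ?thesis
    by (intro linearI; subst ricci_operator_iff[OF assms], intro allI)
      (simp_all add: L bilinear_ladd[OF b] bilinear_lmul[OF b] bilinear_ladd[OF n] bilinear_lmul[OF n])
qed

end

theory Submission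
  imports Defs
begin

text \<open>Subtracting \<open>\<eta> = R$4$4\<close> annihilates the last row of the matrix of Ric, so the image of
  \<open>\<delta> = Ric - \<eta>\<close> lies in the abelian ideal spanned by \<open>e 1, e 2, e 3\<close>. The Leibniz rule for \<open>\<delta>\<close>
  therefore only has content on the brackets with \<open>e 4\<close>, where it says that \<open>\<delta>\<close> restricted to the
  ideal commutes with \<open>x \<mapsto> [x, e 4]\<close>. That map is the direct sum of the scalar \<open>\<alpha>\<close> and a
  block with eigenvalues \<open>\<beta> \<plusminus> \<i>\<close>, which are not real; hence the relations force the off-diagonal
  blocks to vanish for every \<open>\<beta>\<close>, not only for \<open>\<beta> = 0\<close>.\<close>

lemma vector_4 [simp]:
  "(vector [w, x, y, z] :: 'a::zero ^ 4) $ 1 = w"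
  "(vector [w, x, y, z] :: 'a::zero ^ 4) $ 2 = x"
  "(vector [w, x, y, z] :: 'a::zero ^ 4) $ 3 = y"
  "(vector [w, x, y, z] :: 'a::zero ^ 4) $ 4 = z"
  unfolding vector_def by simp_all

text \<open>Both sides of the Leibniz rule are bilinear, so agreement on pairs from a spanning
  family suffices.\<close>

lemma derivation_of_basis:
  fixes e :: "'n::finite \<Rightarrow> 'g::real_vector"
  assumes e: "span (range e) = UNIV" and br: "bilinear br" and D: "linear D"
    and basis: "\<And>i j. D (br (e i) (e j)) = br (D (e i)) (e j) + br (e i) (D (e j))"
  shows "derivation br D"
proof -
  let ?f = "\<lambda>x y. D (br x y)" and ?h = "\<lambda>x y. br (D x) y + br x (D y)"
  note s = linear_add[OF D] linear_scale[OF D] bilinear_ladd[OF br] bilinear_radd[OF br]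
    bilinear_lmul[OF br] bilinear_rmul[OF br]
  have "bilinear ?f" "bilinear ?h"
    unfolding bilinear_def by (intro conjI allI linearI; simp add: s algebra_simps)+
  then have "?f x y = ?h x y" for x y
    by (rule bilinear_eq[of _ _ UNIV "range e" UNIV "range e"]) (use e basis in auto)
  with D show ?thesis by (simp add: derivation_def)
qed

lemma matrix_wrt_shift:
  assumes e: "is_basis e"
  shows "matrix_wrt e (\<lambda>x. f x - c *\<^sub>R x) = matrix_wrt e f - c *\<^sub>R mat 1"
proof -
  note r = is_basis_linear_representation[OF e]
  show ?thesis
    by (simp add: vec_eq_iff matrix_wrt_def mat_def linear_diff[OF r] linear_scale[OF r]
        is_basis_representation[OF e])
qed

text \<open>The hypotheses say that (x, y) is mapped to \<open>c\<close> times itself by the quarter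
  turn (x, y) -> (y, -x), whose eigenvalues are not real; substitution leaves the positive factor 1
  + c^2.\<close>

lemma no_real_eigenvector_rotation:
  fixes c x y :: real
  assumes "y = c * x" "x = - c * y"
  shows "x = 0 \<and> y = 0"
proof -
  have "(1 + c\<^sup>2) * x = 0" using assms by algebra
  then have "x = 0" by (simp add: add_nonneg_eq_0_iff)
  with assms(1) show ?thesis by simp
qed

text \<open>On the span of \<open>e 2\<close> and \<open>e 3\<close>, both \<open>D\<close> and the
  bracket with \<open>e 4\<close> are combinations of the identity and a quarter turn, so they
  commute. Column 4 is free above its last entry: those entries add to \<open>D (e 4)\<close> an
  element of the abelian ideal, invisible to brackets with \<open>e 1\<close>, \<open>e 2\<close>,
  \<open>e 3\<close>.\<close>

lemma derivation_4_6I: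
  fixes M :: "real^4^4"
  assumes L: "lie_algebra_4_6 \<alpha> \<beta> br e" and D: "linear D" and M: "matrix_wrt e D = M"
    and "M$4$1 = 0" "M$4$2 = 0" "M$4$3 = 0" "M$4$4 = 0" "M$3$3 = M$2$2" "M$3$2 = - M$2$3"
    and "M$1$2 = 0" "M$1$3 = 0" "M$2$1 = 0" "M$3$1 = 0"
  shows "derivation br D"
proof -
  have e: "is_basis e" and br: "bilinear br" and alt: "br x x = 0" for x
    using L by (auto simp: lie_algebra_4_6_def lie_algebra_def)
  have skew: "br x y = - br y x" for x y
  proof -
    have "br (x + y) (x + y) = br x x + br x y + (br y x + br y y)"
      by (simp only: bilinear_ladd[OF br] bilinear_radd[OF br] add_ac)
    then show ?thesis by (simp add: alt eq_neg_iff_add_eq_0)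
  qed
  \<comment> \<open>Fixed instances of \<open>skew\<close> complete the bracket table; as a general
    rewrite rule it could be applied to its own result.\<close>
  note brackets = L[unfolded lie_algebra_4_6_def]
    skew[of "e 2" "e 1"] skew[of "e 3" "e 1"] skew[of "e 3" "e 2"]
    skew[of "e 4" "e 1"] skew[of "e 4" "e 2"] skew[of "e 4" "e 3"]
  have col: "D (e j) = M$1$j *\<^sub>R e 1 + M$2$j *\<^sub>R e 2 + M$3$j *\<^sub>R e 3 + M$4$j *\<^sub>R e 4" for j
    using matrix_wrt_column[OF e, of D j] by (simp add: M sum_4)
  note s = linear_add[OF D] linear_diff[OF D] linear_neg[OF D] linear_scale[OF D] linear_0[OF D]
    bilinear_ladd[OF br] bilinear_radd[OF br] bilinear_lmul[OF br] bilinear_rmul[OF br]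
    bilinear_lneg[OF br] bilinear_rneg[OF br]
  have "\<forall>i j. D (br (e i) (e j)) = br (D (e i)) (e j) + br (e i) (D (e j))"
    by (simp add: forall_4 alt brackets s col assms(4-) algebra_simps)
  then show ?thesis
    using e br D by (intro derivation_of_basis) (auto simp: is_basis_def)
qed

theorem theorem4p6:
  fixes \<alpha> \<beta> :: real
    and br :: "'g::real_vector \<Rightarrow> 'g \<Rightarrow> 'g"
    and e :: "4 \<Rightarrow> 'g"
    and g :: "'g \<Rightarrow> 'g \<Rightarrow> real"
    and R :: "real^4^4"
  assumes "\<alpha> > 0"
    and "lie_algebra_4_6 \<alpha> \<beta> br e"
    and "pseudo_riemannian g"
    and "R = matrix_wrt e (ricci_operator br g)"
    and "R$4$1 = 0" and "R$4$2 = 0" and "R$4$3 = 0"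
    and "R$3$3 = R$2$2"
    and "R$3$2 = - R$2$3"
    and "\<beta> * R$2$1 + R$3$1 = \<alpha> * R$2$1"
    and "- R$2$1 + \<beta> * R$3$1 = \<alpha> * R$3$1"
    and "\<alpha> * R$1$2 = \<beta> * R$1$2 - R$1$3"
    and "\<alpha> * R$1$3 = R$1$2 + \<beta> * R$1$3"
  shows "algebraic_ricci_soliton br g \<and>
    (let \<eta> = R$4$4;
         D = (vector [vector [R$1$1 - R$4$4, R$1$2, R$1$3, R$1$4],
                      vector [R$2$1, R$2$2 - R$4$4, R$2$3, R$2$4],
                      vector [R$3$1, - R$2$3, R$2$2 - R$4$4, R$3$4],
                      vector [0, 0, 0, 0]] :: real^4^4)
     in R = \<eta> *\<^sub>R mat 1 + D \<and>
        (\<exists>\<delta>. derivation br \<delta> \<and> matrix_wrt e \<delta> = D \<and>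
             (\<forall>x. ricci_operator br g x = \<eta> *\<^sub>R x + \<delta> x)) \<and>
        (\<beta> = 0 \<longrightarrow>
           R$1$2 = 0 \<and> R$1$3 = 0 \<and> R$2$1 = 0 \<and> R$3$1 = 0 \<and>
           D = vector [vector [R$1$1 - R$4$4, 0, 0, R$1$4],
                       vector [0, R$2$2 - R$4$4, R$2$3, R$2$4],
                       vector [0, - R$2$3, R$2$2 - R$4$4, R$3$4],
                       vector [0, 0, 0, 0]]))"
proof -
  let ?Ric = "ricci_operator br g"
  define D :: "real^4^4" where
    "D = vector [vector [R$1$1 - R$4$4, R$1$2, R$1$3, R$1$4],
                 vector [R$2$1, R$2$2 - R$4$4, R$2$3, R$2$4],
                 vector [R$3$1, - R$2$3, R$2$2 - R$4$4, R$3$4],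
                 vector [0, 0, 0, 0]]"
  define \<delta> where "\<delta> = (\<lambda>x. ?Ric x - R$4$4 *\<^sub>R x)"
  have br: "lie_algebra br" and e: "is_basis e"
    using assms(2) by (auto simp: lie_algebra_4_6_def)
  \<comment> \<open>The last row and the shape of the 2-3 block are where \<open>D\<close> differs
    in form from \<open>R\<close>; the first five relations supply these entries.\<close>
  have R: "R = R$4$4 *\<^sub>R mat 1 + D"
    using assms(5-9) by (simp add: vec_eq_iff forall_4 D_def mat_def)
  have mat: "matrix_wrt e \<delta> = D"
    \<comment> \<open>Only one occurrence is replaced, because \<open>R\<close> recurs on the
      right-hand side of the equation.\<close>
    unfolding \<delta>_def matrix_wrt_shift[OF e] assms(4)[symmetric] by (subst (1) R) simp
  have lin: "linear \<delta>"
    unfolding \<delta>_def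
    by (intro linear_compose_sub linear_ricci_operator[OF br e assms(3)] linear_scale_self)
  have zero: "R$1$2 = 0 \<and> R$1$3 = 0 \<and> R$2$1 = 0 \<and> R$3$1 = 0"
  proof -
    \<comment> \<open>Two eigenvector problems with c = \<alpha> - \<beta>: (x, y) is
      (\<open>R$2$1\<close>, \<open>R$3$1\<close>) in the first and (\<open>R$1$3\<close>,
      \<open>R$1$2\<close>) in the second.\<close>
    have "R$3$1 = (\<alpha> - \<beta>) * R$2$1" "R$2$1 = - (\<alpha> - \<beta>) * R$3$1"
      "R$1$2 = (\<alpha> - \<beta>) * R$1$3" "R$1$3 = - (\<alpha> - \<beta>) * R$1$2"
      unfolding left_diff_distrib minus_diff_eq using assms(10-13) by linarith+
    then show ?thesis
      by (blast dest: no_real_eigenvector_rotation)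
  qed
  have der: "derivation br \<delta>"
    by (rule derivation_4_6I[OF assms(2) lin mat]) (use zero in \<open>simp_all add: D_def\<close>)
  have Ric: "?Ric x = R$4$4 *\<^sub>R x + \<delta> x" for x
    by (simp add: \<delta>_def)
  have "algebraic_ricci_soliton br g"
    using der Ric by (auto simp: algebraic_ricci_soliton_def)
  moreover have "\<exists>\<delta>. derivation br \<delta> \<and> matrix_wrt e \<delta> = D \<and> (\<forall>x. ?Ric x = R$4$4 *\<^sub>R x + \<delta> x)"
    using der mat Ric by blast
  moreover have "D = vector [vector [R$1$1 - R$4$4, 0, 0, R$1$4],
                             vector [0, R$2$2 - R$4$4, R$2$3, R$2$4],
                             vector [0, - R$2$3, R$2$2 - R$4$4, R$3$4],
                             vector [0, 0, 0, 0]]"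
    unfolding D_def by (simp only: zero)
  ultimately show ?thesis
    unfolding Let_def D_def[symmetric] using R zero by blast
qed

end
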